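(* Let $m,n,k\ge1$ be integers, and let $(a_1,\ldots,a_n)$ and $(b_1,\ldots,b_n)$ be sequences of integers with $0\le a_i,b_i\le m$ for all $i$ and $$a_1+\cdots+a_n=b_1+\cdots+b_n=k.$$ Let $\mathcal A=(A_1,\ldots,A_k)$ be the collection of points of $[m\times n]$ consisting, for each $i=1,\ldots,n$, of exactly the $a_i$ bottom points of the $i$-th column, i.e. the points $(p,i)$ with $m-a_i+1\le p\le m$. Let $\mathcal B=(B_1,\ldots,B_k)$ be the collection of points of $[m\times n]$ consisting, for each $i=1,\ldots,n$, of exactly the $b_i$ top points of the $i$-th column, i.e. the points $(p,i)$ with $1\le p\le b_i$. Here the points in both $\mathcal A$ and $\mathcal B$ are ordered (indexed) by columns from left to right, and within a column from top to bottom. Then the multivariate rational function $$F_{\mathcal A,\mathcal B}(x_1,\ldots,x_m\mid y_1,\ldots,y_n)=\sum_{\Upsilon:\,\mathcal A\to\mathcal B} w(\Upsilon)$$ is symmetric in $(x_1,\ldots,x_m)$.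
   Context: Let $[m\times n]=\{(p,q)\in\mathbb N^2: 1\le p\le m,\ 1\le q\le n\}$, with matrix coordinates: the first coordinate (row index) increases downwards and the second coordinate (column index) increases from left to right; thus row $1$ is the top row and row $m$ is the bottom row. A lattice path $\gamma:A\to B$ is a sequence of points of $[m\times n]$ starting at $A$ and ending at $B$ using only Up steps $(p,q)\to(p-1,q)$ and Right steps $(p,q)\to(p,q+1)$ (a path with no steps is allowed when $A=B$); it is identified with the set of points it visits, including both endpoints. For $k$-tuples of points $\mathcal A=(A_1,\ldots,A_k)$ and $\mathcal B=(B_1,\ldots,B_k)$ in $[m\times n]$, $\Upsilon:\mathcal A\to\mathcal B$ denotes a collection $\Upsilon=(\gamma_1,\ldots,\gamma_k)$ of non-intersecting (pairwise having no common point) lattice paths $\gamma_i:A_i\to B_i$. The weights are $$w(\gamma)=\prod_{(i,j)\in\gamma}\frac1{x_i+y_j},\qquad w(\Upsilon)=\prod_{i=1}^k w(\gamma_i),$$ where $x_1,\ldots,x_m,y_1,\ldots,y_n$ are independent variables. The sum defining $F_{\mathcal A,\mathcal B}$ is over all such collections $\Upsilon$ (an empty sum is $0$). Symmetric in $(x_1,\ldots,x_m)$ means invariant, as a rational function, under all permutations of $x_1,\ldots,x_m$ with the $y_j$ fixed. *)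

theory Defs
  imports
    "HOL-Library.Poly_Mapping"
    "HOL-Computational_Algebra.Fraction_Field"
    "HOL-Combinatorics.Permutations"
begin

subsection \<open>Rational functions in the variables \<open>x\<^sub>1, x\<^sub>2, \<dots>\<close> and \<open>y\<^sub>1, y\<^sub>2, \<dots>\<close>\<close>

datatype xyvar = X nat | Y nat

text \<open>
  The linear order on variables has no mathematical content; it is what makes the polynomials below
  an instance of \<^class>\<open>idom\<close>, so that their fraction field can be formed.
\<close>

instantiation xyvar :: linorder
begin

fun less_eq_xyvar :: "xyvar \<Rightarrow> xyvar \<Rightarrow> bool" where
  "X i \<le> X j \<longleftrightarrow> i \<le> j"
| "X i \<le> Y j \<longleftrightarrow> True"
| "Y i \<le> X j \<longleftrightarrow> False"
| "Y i \<le> Y j \<longleftrightarrow> i \<le> j"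

definition less_xyvar :: "xyvar \<Rightarrow> xyvar \<Rightarrow> bool" where
  "less_xyvar u v \<longleftrightarrow> u \<le> v \<and> \<not> v \<le> u"

instance
proof
  fix u v w :: xyvar
  show "u < v \<longleftrightarrow> u \<le> v \<and> \<not> v \<le> u" by (simp add: less_xyvar_def)
  show "u \<le> u" by (cases u) auto
  show "u \<le> w" if "u \<le> v" "v \<le> w" using that by (cases u; cases v; cases w) auto
  show "u = v" if "u \<le> v" "v \<le> u" using that by (cases u; cases v) auto
  show "u \<le> v \<or> v \<le> u" by (cases u; cases v) auto
qed

end

text \<open>
  A monomial is a finitely supported exponent vector, a polynomial a finitely supported coefficient
  function on monomials; multiplication is convolution.
\<close>

type_synonym 'c mpoly = "(xyvar \<Rightarrow>\<^sub>0 nat) \<Rightarrow>\<^sub>0 'c"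
type_synonym 'c ratfun = "'c mpoly fract"

definition indet :: "xyvar \<Rightarrow> 'c::field ratfun" where
  "indet v = Fract (Poly_Mapping.single (Poly_Mapping.single v 1) 1) 1"

abbreviation x_var :: "nat \<Rightarrow> 'c::field ratfun" where "x_var i \<equiv> indet (X i)"
abbreviation y_var :: "nat \<Rightarrow> 'c::field ratfun" where "y_var j \<equiv> indet (Y j)"

text \<open>
  Renaming the variables of a polynomial along a bijection \<open>\<pi>\<close>, each variable \<open>v\<close> becoming \<open>\<pi> v\<close>:
  the coefficient of a monomial \<open>t\<close> in the result is the coefficient of \<open>t \<circ> \<pi>\<close> in the original.
\<close>

definition rename_poly :: "(xyvar \<Rightarrow> xyvar) \<Rightarrow> 'c::field mpoly \<Rightarrow> 'c mpoly" where
  "rename_poly \<pi> = Poly_Mapping.map_key (Poly_Mapping.map_key \<pi>)"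

lemma bij_map_key:
  assumes "bij \<pi>"
  shows "bij (Poly_Mapping.map_key \<pi> :: (xyvar \<Rightarrow>\<^sub>0 nat) \<Rightarrow> _)"
proof (rule o_bij)
  have i: "inj \<pi>" "inj (inv \<pi>)"
    using assms by (auto simp: bij_is_inj bij_imp_bij_inv)
  show "Poly_Mapping.map_key (inv \<pi>) \<circ> Poly_Mapping.map_key \<pi> = (id :: (xyvar \<Rightarrow>\<^sub>0 nat) \<Rightarrow> _)"
    by (rule ext, rule poly_mapping_eqI)
       (simp add: map_key.rep_eq i surj_f_inv_f[OF bij_is_surj[OF assms]])
  show "(Poly_Mapping.map_key \<pi> :: (xyvar \<Rightarrow>\<^sub>0 nat) \<Rightarrow> _) \<circ> Poly_Mapping.map_key (inv \<pi>) = id"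
    by (rule ext, rule poly_mapping_eqI) (simp add: map_key.rep_eq i)
qed

lemma lookup_rename_poly:
  assumes "bij \<pi>"
  shows "Poly_Mapping.lookup (rename_poly \<pi> p) t =
    Poly_Mapping.lookup p (Poly_Mapping.map_key \<pi> t)"
  using bij_is_inj[OF bij_map_key[OF assms]]
  by (simp add: rename_poly_def map_key.rep_eq)

lemma rename_poly_single:
  assumes "bij \<pi>"
  shows "rename_poly \<pi> (Poly_Mapping.single (Poly_Mapping.map_key \<pi> t) c) = Poly_Mapping.single t c"
  unfolding rename_poly_def
  by (rule map_key_single) (rule bij_is_inj[OF bij_map_key[OF assms]])

lemma map_key_add_mono:
  assumes "bij \<pi>"
  shows "Poly_Mapping.map_key \<pi> (s + t :: xyvar \<Rightarrow>\<^sub>0 nat) =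
    Poly_Mapping.map_key \<pi> s + Poly_Mapping.map_key \<pi> t"
  by (rule map_key_plus) (rule bij_is_inj[OF assms])

lemma rename_poly_add: "bij \<pi> \<Longrightarrow> rename_poly \<pi> (p + q) = rename_poly \<pi> p + rename_poly \<pi> q"
  by (rule poly_mapping_eqI) (simp add: lookup_rename_poly lookup_add)

lemma rename_poly_0: "bij \<pi> \<Longrightarrow> rename_poly \<pi> 0 = 0"
  by (rule poly_mapping_eqI) (simp add: lookup_rename_poly)

lemma rename_poly_eq_0_iff:
  assumes "bij \<pi>"
  shows "rename_poly \<pi> p = 0 \<longleftrightarrow> p = 0"
proof
  assume z: "rename_poly \<pi> p = 0"
  show "p = 0"
  proof (rule poly_mapping_eqI)
    fix t :: "xyvar \<Rightarrow>\<^sub>0 nat"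
    obtain s where s: "t = Poly_Mapping.map_key \<pi> s"
      by (rule surjE[OF bij_is_surj[OF bij_map_key[OF assms]], of t])
    show "Poly_Mapping.lookup p t = Poly_Mapping.lookup 0 t"
      using lookup_rename_poly[OF assms, of p s] z s by simp
  qed
qed (simp add: rename_poly_0 assms)

lemma rename_poly_mult:
  fixes p q :: "'a::field mpoly"
  assumes "bij \<pi>"
  shows "rename_poly \<pi> (p * q) = rename_poly \<pi> p * rename_poly \<pi> q"
proof (rule poly_mapping_eqI)
  fix t
  let ?h = "Poly_Mapping.map_key \<pi> :: (xyvar \<Rightarrow>\<^sub>0 nat) \<Rightarrow> _"
  have b: "bij ?h" by (rule bij_map_key[OF assms])
  have eq: "?h t = ?h l + ?h s \<longleftrightarrow> t = l + s" for l s
    by (simp add: inj_eq[OF bij_is_inj[OF b]] flip: map_key_add_mono[OF assms])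
  have re: "(\<Sum>l. g l) = (\<Sum>l. g (?h l))" for g :: "(xyvar \<Rightarrow>\<^sub>0 nat) \<Rightarrow> 'a"
    by (rule Sum_any.reindex_cong[OF b]) (simp add: o_def)
  have inner: "(\<Sum>s. Poly_Mapping.lookup q s when ?h t = ?h l + s) =
      (\<Sum>s. Poly_Mapping.lookup q (?h s) when t = l + s)" for l
    unfolding re[of "\<lambda>s. Poly_Mapping.lookup q s when ?h t = ?h l + s"] eq ..
  have "Poly_Mapping.lookup (rename_poly \<pi> (p * q)) t =
    (\<Sum>l. Poly_Mapping.lookup p l * (\<Sum>s. Poly_Mapping.lookup q s when ?h t = l + s))"
    unfolding lookup_rename_poly[OF assms] lookup_mult ..
  also have "\<dots> = (\<Sum>l. Poly_Mapping.lookup p (?h l) *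
      (\<Sum>s. Poly_Mapping.lookup q s when ?h t = ?h l + s))"
    by (rule re)
  also have "\<dots> = Poly_Mapping.lookup (rename_poly \<pi> p * rename_poly \<pi> q) t"
    unfolding lookup_mult lookup_rename_poly[OF assms] inner ..
  finally show "Poly_Mapping.lookup (rename_poly \<pi> (p * q)) t =
      Poly_Mapping.lookup (rename_poly \<pi> p * rename_poly \<pi> q) t" .
qed

lemma rename_poly_1:
  assumes "bij \<pi>"
  shows "rename_poly \<pi> (1 :: 'c::field mpoly) = 1"
proof -
  have "Poly_Mapping.map_key \<pi> (0 :: xyvar \<Rightarrow>\<^sub>0 nat) = 0"
    by (rule map_key_zero) (rule bij_is_inj[OF assms])
  then show ?thesis
    using rename_poly_single[OF assms, of 0 "1 :: 'c"] by simp
qed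

text \<open>
  The induced automorphism of the field of rational functions. For \<open>\<pi>\<close> not bijective the value is
  irrelevant.
\<close>

lift_definition rename :: "(xyvar \<Rightarrow> xyvar) \<Rightarrow> 'c::field ratfun \<Rightarrow> 'c ratfun"
  is "\<lambda>\<pi> (P, Q). if bij \<pi> then (rename_poly \<pi> P, rename_poly \<pi> Q) else (P, Q)"
  by (auto simp: rename_poly_eq_0_iff split: if_splits simp flip: rename_poly_mult)

lemma rename_Fract:
  assumes "bij \<pi>"
  shows "rename \<pi> (Fract P Q) = Fract (rename_poly \<pi> P) (rename_poly \<pi> Q)"
  unfolding Fract.abs_eq
  by (subst rename.abs_eq)
     (use assms in \<open>auto simp: rename_poly_eq_0_iff rename_poly_0 rename_poly_1\<close>)

lemma rename_indet:
  assumes "bij \<pi>"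
  shows "rename \<pi> (indet v :: 'c::field ratfun) = indet (\<pi> v)"
proof -
  have "Poly_Mapping.map_key \<pi> (Poly_Mapping.single (\<pi> v) (1::nat)) = Poly_Mapping.single v 1"
    by (rule map_key_single) (rule bij_is_inj[OF assms])
  then have "rename_poly \<pi> (Poly_Mapping.single (Poly_Mapping.single v 1) (1 :: 'c)) =
      Poly_Mapping.single (Poly_Mapping.single (\<pi> v) 1) 1"
    using rename_poly_single[OF assms, of "Poly_Mapping.single (\<pi> v) 1" "1 :: 'c"] by metis
  then show ?thesis
    unfolding indet_def rename_Fract[OF assms] rename_poly_1[OF assms] by (rule arg_cong)
qed

lemma rename_add:
  assumes "bij \<pi>"
  shows "rename \<pi> (f + g) = rename \<pi> f + rename \<pi> g"
proof -
  obtain P Q where f: "f = Fract P Q" "Q \<noteq> 0" by (rule Fract_cases)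
  obtain R S where g: "g = Fract R S" "S \<noteq> 0" by (rule Fract_cases)
  show ?thesis
    using f g assms
    by (simp add: rename_Fract rename_poly_add rename_poly_mult rename_poly_eq_0_iff)
qed

lemma rename_mult:
  assumes "bij \<pi>"
  shows "rename \<pi> (f * g) = rename \<pi> f * rename \<pi> g"
proof -
  obtain P Q where f: "f = Fract P Q" by (rule Fract_cases)
  obtain R S where g: "g = Fract R S" by (rule Fract_cases)
  show ?thesis
    using assms by (simp add: f g rename_Fract rename_poly_mult)
qed

lemma rename_1:
  assumes "bij \<pi>"
  shows "rename \<pi> 1 = 1"
  using assms by (simp add: One_fract_def rename_Fract rename_poly_1)

text \<open>The action of a permutation of the \<open>x\<close>-indices, with all \<open>y\<^sub>j\<close> fixed.\<close>

fun permute_X :: "(nat \<Rightarrow> nat) \<Rightarrow> xyvar \<Rightarrow> xyvar" where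
  "permute_X \<sigma> (X i) = X (\<sigma> i)"
| "permute_X \<sigma> (Y j) = Y j"

lemma bij_permute_X:
  assumes "\<sigma> permutes S"
  shows "bij (permute_X \<sigma>)"
proof (rule o_bij)
  show "permute_X (inv \<sigma>) \<circ> permute_X \<sigma> = id"
  proof
    fix v show "(permute_X (inv \<sigma>) \<circ> permute_X \<sigma>) v = id v"
      using permutes_inverses[OF assms] by (cases v) auto
  qed
  show "permute_X \<sigma> \<circ> permute_X (inv \<sigma>) = id"
  proof
    fix v show "(permute_X \<sigma> \<circ> permute_X (inv \<sigma>)) v = id v"
      using permutes_inverses[OF assms] by (cases v) auto
  qed
qed

definition symmetric_in_x :: "nat \<Rightarrow> 'c::field ratfun \<Rightarrow> bool" where
  "symmetric_in_x m f \<longleftrightarrow> (\<forall>\<sigma>. \<sigma> permutes {1..m} \<longrightarrow> rename (permute_X \<sigma>) f = f)"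

lemma x_var_plus_y_var_nonzero: "x_var i + y_var j \<noteq> (0 :: 'c::field ratfun)"
proof
  let ?s = "\<lambda>v. Poly_Mapping.single (Poly_Mapping.single v (1::nat)) (1::'c)"
  assume "x_var i + y_var j = (0 :: 'c ratfun)"
  then have "?s (X i) + ?s (Y j) = 0"
    by (simp add: indet_def Zero_fract_def eq_fract)
  then have "Poly_Mapping.lookup (?s (X i) + ?s (Y j)) (Poly_Mapping.single (X i) 1) = 0"
    by simp
  moreover have "Poly_Mapping.single (Y j) (1::nat) \<noteq> Poly_Mapping.single (X i) 1"
  proof
    assume "Poly_Mapping.single (Y j) (1::nat) = Poly_Mapping.single (X i) 1"
    then have "Poly_Mapping.lookup (Poly_Mapping.single (Y j) (1::nat)) (X i) =
        Poly_Mapping.lookup (Poly_Mapping.single (X i) 1) (X i)" by simp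
    then show False by (simp add: lookup_single_not_eq)
  qed
  ultimately show False
    by (simp add: lookup_add lookup_single_not_eq)
qed


subsection \<open>Non-intersecting lattice paths\<close>

text \<open>Points are pairs (row, column), rows being numbered downwards from the top.\<close>

type_synonym point = "nat \<times> nat"

definition grid :: "nat \<Rightarrow> nat \<Rightarrow> point set" where
  "grid m n = {1..m} \<times> {1..n}"

definition lattice_step :: "point \<Rightarrow> point \<Rightarrow> bool" where
  "lattice_step u v \<longleftrightarrow>
     (fst u = Suc (fst v) \<and> snd v = snd u) \<or> (fst v = fst u \<and> snd v = Suc (snd u))"

definition lattice_path :: "nat \<Rightarrow> nat \<Rightarrow> point \<Rightarrow> point \<Rightarrow> point list \<Rightarrow> bool" where
  "lattice_path m n P Q \<gamma> \<longleftrightarrow>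
     \<gamma> \<noteq> [] \<and> hd \<gamma> = P \<and> last \<gamma> = Q \<and> set \<gamma> \<subseteq> grid m n \<and> successively lattice_step \<gamma>"

definition nonintersecting_paths ::
    "nat \<Rightarrow> nat \<Rightarrow> point list \<Rightarrow> point list \<Rightarrow> point list list set" where
  "nonintersecting_paths m n As Bs =
     {\<Upsilon>. length \<Upsilon> = length As \<and> length \<Upsilon> = length Bs \<and>
         (\<forall>i < length \<Upsilon>. lattice_path m n (As ! i) (Bs ! i) (\<Upsilon> ! i)) \<and>
         (\<forall>i < length \<Upsilon>. \<forall>j < length \<Upsilon>. i \<noteq> j \<longrightarrow> set (\<Upsilon> ! i) \<inter> set (\<Upsilon> ! j) = {})}"

lemma lattice_path_distinct:
  assumes "lattice_path m n P Q \<gamma>"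
  shows "distinct \<gamma>"
proof -
  let ?h = "\<lambda>u :: point. int (snd u) - int (fst u)"
  have "successively (\<lambda>u v. ?h u < ?h v) \<gamma>"
    using assms unfolding lattice_path_def
    by (auto elim!: successively_mono simp: lattice_step_def)
  then have "sorted_wrt (\<lambda>u v. ?h u < ?h v) \<gamma>"
    by (subst (asm) successively_conv_sorted_wrt) (auto intro!: transpI)
  then have "sorted_wrt (<) (map ?h \<gamma>)"
    by (simp add: sorted_wrt_map)
  then show ?thesis
    by (metis distinct_map strict_sorted_iff)
qed

lemma finite_nonintersecting_paths: "finite (nonintersecting_paths m n As Bs)"
proof (rule finite_subset)
  let ?D = "{\<gamma>. set \<gamma> \<subseteq> grid m n \<and> distinct \<gamma>}"
  have "finite ?D"
    by (rule finite_subset_distinct) (simp add: grid_def)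
  then show "finite {\<Upsilon>. set \<Upsilon> \<subseteq> ?D \<and> length \<Upsilon> = length As}"
    by (rule finite_lists_length_eq)
  show "nonintersecting_paths m n As Bs \<subseteq> {\<Upsilon>. set \<Upsilon> \<subseteq> ?D \<and> length \<Upsilon> = length As}"
  proof
    fix \<Upsilon> assume \<Upsilon>: "\<Upsilon> \<in> nonintersecting_paths m n As Bs"
    have "\<gamma> \<in> ?D" if \<gamma>: "\<gamma> \<in> set \<Upsilon>" for \<gamma>
    proof -
      obtain i where "lattice_path m n (As ! i) (Bs ! i) \<gamma>"
        using \<Upsilon> \<gamma> unfolding nonintersecting_paths_def in_set_conv_nth by blast
      then show ?thesis
        using lattice_path_distinct[of m n] unfolding lattice_path_def by blast
    qed
    then show "\<Upsilon> \<in> {\<Upsilon>. set \<Upsilon> \<subseteq> ?D \<and> length \<Upsilon> = length As}"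
      using \<Upsilon> unfolding nonintersecting_paths_def by blast
  qed
qed

definition path_weight :: "(nat \<Rightarrow> 'f::field) \<Rightarrow> (nat \<Rightarrow> 'f) \<Rightarrow> point list \<Rightarrow> 'f" where
  "path_weight x y \<gamma> = (\<Prod>(i, j)\<in>set \<gamma>. 1 / (x i + y j))"

definition paths_weight :: "(nat \<Rightarrow> 'f::field) \<Rightarrow> (nat \<Rightarrow> 'f) \<Rightarrow> point list list \<Rightarrow> 'f" where
  "paths_weight x y \<Upsilon> = (\<Prod>i < length \<Upsilon>. path_weight x y (\<Upsilon> ! i))"

definition path_sum ::
    "nat \<Rightarrow> nat \<Rightarrow> point list \<Rightarrow> point list \<Rightarrow> (nat \<Rightarrow> 'f::field) \<Rightarrow> (nat \<Rightarrow> 'f) \<Rightarrow> 'f" where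
  "path_sum m n As Bs x y = (\<Sum>\<Upsilon>\<in>nonintersecting_paths m n As Bs. paths_weight x y \<Upsilon>)"

definition F_ratfun :: "nat \<Rightarrow> nat \<Rightarrow> point list \<Rightarrow> point list \<Rightarrow> 'c::field ratfun" where
  "F_ratfun m n As Bs = path_sum m n As Bs x_var y_var"

definition bottom_points :: "nat \<Rightarrow> nat \<Rightarrow> (nat \<Rightarrow> nat) \<Rightarrow> point list" where
  "bottom_points m n a = concat (map (\<lambda>i. map (\<lambda>p. (p, i)) [m - a i + 1..<m + 1]) [1..<n + 1])"

definition top_points :: "nat \<Rightarrow> (nat \<Rightarrow> nat) \<Rightarrow> point list" where
  "top_points n b = concat (map (\<lambda>i. map (\<lambda>p. (p, i)) [1..<b i + 1]) [1..<n + 1])"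

lemma set_bottom_points:
  "set (bottom_points m n a) = {(p, i). i \<in> {1..n} \<and> m - a i + 1 \<le> p \<and> p \<le> m}"
  by (auto simp: bottom_points_def image_iff simp del: upt_Suc)

lemma set_top_points:
  "set (top_points n b) = {(p, i). i \<in> {1..n} \<and> 1 \<le> p \<and> p \<le> b i}"
  by (auto simp: top_points_def image_iff simp del: upt_Suc)

lemma length_bottom_points:
  assumes "\<And>i. i \<in> {1..n} \<Longrightarrow> a i \<le> m"
  shows "length (bottom_points m n a) = (\<Sum>i=1..n. a i)"
proof -
  have "length (bottom_points m n a) = (\<Sum>i\<leftarrow>[1..<n + 1]. m - (m - a i))"
    by (simp add: bottom_points_def length_concat o_def del: upt_Suc)
  also have "\<dots> = (\<Sum>i=1..n. m - (m - a i))"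
    by (subst interv_sum_list_conv_sum_set_nat) (rule sum.cong, auto)
  also have "\<dots> = (\<Sum>i=1..n. a i)"
    by (rule sum.cong) (use assms in auto)
  finally show ?thesis .
qed

lemma length_top_points: "length (top_points n b) = (\<Sum>i=1..n. b i)"
proof -
  have "length (top_points n b) = (\<Sum>i\<leftarrow>[1..<n + 1]. b i)"
    by (simp add: top_points_def length_concat o_def del: upt_Suc)
  also have "\<dots> = (\<Sum>i=1..n. b i)"
    by (subst interv_sum_list_conv_sum_set_nat) (rule sum.cong, auto)
  finally show ?thesis .
qed

end

theory Submission
  imports Defs
begin

text \<open>
  Cut the grid into its columns. What the columns \<open>c, \<dots>, n\<close> have to know about the columns before
  them is only the set \<open>S\<close> of rows in which a path steps right into column \<open>c\<close>; let \<open>f\<^sub>c S\<close> be the sum of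
  the weights of everything that can happen in the columns \<open>c, \<dots>, n\<close> from there. The function of the
  theorem is \<open>f\<^sub>1\<close> at the empty set.

  For a nonempty \<open>S\<close> the value \<open>f\<^sub>c S\<close> is not symmetric in the \<open>x\<^sub>i\<close>, but it fails to be so in a way that
  does not depend on \<open>c\<close>: interchanging \<open>x\<^sub>r\<close> and \<open>x\<^bsub>r+1\<^esub>\<close> turns \<open>f\<^sub>c S\<close> into
  \<open>f\<^sub>c S + (x\<^sub>r - x\<^bsub>r+1\<^esub>) f\<^sub>c (S - {r} \<union> {r + 1})\<close>
  if \<open>r \<in> S\<close> and \<open>r + 1 \<notin> S\<close>, and leaves it alone for all other \<open>S\<close> (\<open>grid_sum_exchange\<close>). At the empty
  set this is invariance under adjacent transpositions, hence symmetry.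

  The reason is seen on a single path. Let \<open>L\<close> be the \<open>m \<times> m\<close> matrix with diagonal \<open>x\<^sub>1, \<dots>, x\<^sub>m\<close> and with
  \<open>-1\<close> at the places \<open>(p, p - 1)\<close>. The weights of the ways through column \<open>c\<close> from row \<open>p\<close> to row \<open>q\<close> form
  the matrix \<open>(L + y\<^sub>c)\<^sup>-\<^sup>1\<close>. Interchanging \<open>x\<^sub>r\<close> and \<open>x\<^bsub>r+1\<^esub>\<close> conjugates \<open>L\<close> by the unipotent matrix
  \<open>1 + (x\<^sub>r - x\<^bsub>r+1\<^esub>) E\<^bsub>r,r+1\<^esub>\<close>, in which no \<open>y\<^sub>c\<close> occurs, so one change of basis serves all columns at
  once. The rule above is the action of this matrix on sets of rows, that is, on exterior powers.
  The starting points in a column are a bottom block of rows and the end points a top block: a bottom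
  block containing \<open>r\<close> contains \<open>r + 1\<close>, a top block containing \<open>r + 1\<close> contains \<open>r\<close>, and this is what
  makes starting and ending in a column compatible with the change of basis.

  Two facts carry the proof. One is a recursion for the path sum that
  moves one starting point at a time, always the lowest one in the leftmost occupied column: no other
  path can visit that point, so the step is unconstrained (\<open>path_sum_step\<close>, \<open>path_sum_end\<close>). The
  order of the starting points, and with it the prescribed pairing with the end points, survives such
  steps, so the path sum becomes an iterated sum over sets of rows (\<open>column_sum_eq_path_sum\<close>). The
  other is that the exchange rule passes through one column; this comes down to the two rows \<open>r\<close> and
  \<open>r + 1\<close> of that column, where it is the identity \<open>w' = w + d w w'\<close> for \<open>w = 1 / (x\<^sub>r + y\<^sub>c)\<close>,
  \<open>w' = 1 / (x\<^bsub>r+1\<^esub> + y\<^sub>c)\<close> and \<open>d = x\<^sub>r - x\<^bsub>r+1\<^esub>\<close> (\<open>column_sum_exchange_two_rows\<close>).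
\<close>

section \<open>Paths avoiding a set of points\<close>

definition avoiding_paths :: "nat \<Rightarrow> nat \<Rightarrow> point set \<Rightarrow> point \<Rightarrow> point \<Rightarrow> point list set" where
  "avoiding_paths m n D P Q = {\<gamma>. lattice_path m n P Q \<gamma> \<and> set \<gamma> \<inter> D = {}}"

lemma finite_avoiding_paths: "finite (avoiding_paths m n D P Q)"
proof (rule finite_subset)
  show "finite {\<gamma>. set \<gamma> \<subseteq> grid m n \<and> distinct \<gamma>}"
    by (rule finite_subset_distinct) (simp add: grid_def)
  show "avoiding_paths m n D P Q \<subseteq> {\<gamma>. set \<gamma> \<subseteq> grid m n \<and> distinct \<gamma>}"
    using lattice_path_distinct by (auto simp: avoiding_paths_def lattice_path_def)
qed

lemma lattice_path_points:
  assumes "lattice_path m n P Q \<gamma>" and "z \<in> set \<gamma>"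
  shows "snd P \<le> snd z \<and> fst z \<le> fst P"
proof -
  have "successively lattice_step \<gamma> \<Longrightarrow> \<gamma> \<noteq> [] \<Longrightarrow> z \<in> set \<gamma> \<Longrightarrow>
      snd (hd \<gamma>) \<le> snd z \<and> fst z \<le> fst (hd \<gamma>)" for \<gamma>
    by (induction \<gamma> rule: induct_list012) (auto simp: lattice_step_def)
  then show ?thesis
    using assms by (auto simp: lattice_path_def)
qed

lemma lattice_path_Cons_iff:
  "lattice_path m n P Q (z # \<gamma>) \<longleftrightarrow> z = P \<and> P \<in> grid m n \<and>
     (\<gamma> = [] \<and> P = Q \<or> \<gamma> \<noteq> [] \<and> lattice_step P (hd \<gamma>) \<and> lattice_path m n (hd \<gamma>) Q \<gamma>)"
  by (cases \<gamma>) (auto simp: lattice_path_def)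

lemma avoiding_paths_trivial:
  assumes "P \<in> grid m n" "P \<notin> D"
  shows "avoiding_paths m n D P P = {[P]}"
proof -
  have "\<gamma> = [P]" if \<gamma>: "lattice_path m n P P \<gamma>" for \<gamma>
  proof -
    obtain \<gamma>' where \<gamma>': "\<gamma> = P # \<gamma>'"
      using \<gamma> by (cases \<gamma>) (auto simp: lattice_path_def)
    have "\<gamma>' = []"
    proof (rule ccontr)
      assume "\<gamma>' \<noteq> []"
      then have "P \<in> set \<gamma>'"
        using \<gamma> \<gamma>' by (auto simp: lattice_path_def)
      then show False
        using lattice_path_distinct[OF \<gamma>] \<gamma>' by simp
    qed
    then show ?thesis using \<gamma>' by simp
  qed
  then show ?thesis
    using assms by (auto simp: avoiding_paths_def lattice_path_Cons_iff)
qed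

lemma avoiding_paths_first_step:
  assumes "(p, c) \<in> grid m n" "(p, c) \<notin> D" "(p, c) \<noteq> Q"
  shows "avoiding_paths m n D (p, c) Q =
    (#) (p, c) ` (avoiding_paths m n D (p - 1, c) Q \<union> avoiding_paths m n D (p, Suc c) Q)"
    (is "?L = ?R")
proof
  show "?L \<subseteq> ?R"
  proof
    fix \<gamma> assume \<gamma>: "\<gamma> \<in> ?L"
    then obtain \<gamma>' where \<gamma>': "\<gamma> = (p, c) # \<gamma>'"
      by (cases \<gamma>) (auto simp: avoiding_paths_def lattice_path_def)
    have "hd \<gamma>' = (p - 1, c) \<or> hd \<gamma>' = (p, Suc c)"
      using \<gamma> assms(3) unfolding \<gamma>' avoiding_paths_def
      by (auto simp: lattice_path_Cons_iff lattice_step_def prod_eq_iff)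
    then show "\<gamma> \<in> ?R"
      using \<gamma> assms(3) unfolding \<gamma>' avoiding_paths_def
      by (auto simp: lattice_path_Cons_iff)
  qed
  show "?R \<subseteq> ?L"
  proof
    fix \<gamma> assume "\<gamma> \<in> ?R"
    then obtain \<gamma>' P where \<gamma>': "\<gamma> = (p, c) # \<gamma>'" "lattice_path m n P Q \<gamma>'" "set \<gamma>' \<inter> D = {}"
      and P: "P = (p - 1, c) \<or> P = (p, Suc c)"
      by (auto simp: avoiding_paths_def)
    have "\<gamma>' \<noteq> []" "hd \<gamma>' = P"
      using \<gamma>'(2) by (auto simp: lattice_path_def)
    moreover have "lattice_step (p, c) P"
      using P assms(1) by (auto simp: lattice_step_def grid_def)
    ultimately show "\<gamma> \<in> ?L"
      using \<gamma>' assms by (auto simp: avoiding_paths_def lattice_path_Cons_iff)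
  qed
qed

lemma path_weight_Cons:
  assumes "(p, c) \<notin> set \<gamma>"
  shows "path_weight x y ((p, c) # \<gamma>) = 1 / (x p + y c) * path_weight x y \<gamma>"
  using assms by (simp add: path_weight_def)

lemma avoiding_path_sum_first_step:
  assumes "(p, c) \<in> grid m n" "(p, c) \<notin> D" "(p, c) \<noteq> Q"
  shows "(\<Sum>\<gamma>\<in>avoiding_paths m n D (p, c) Q. path_weight x y \<gamma>) =
    1 / (x p + y c) * ((\<Sum>\<gamma>\<in>avoiding_paths m n D (p - 1, c) Q. path_weight x y \<gamma>) +
                        (\<Sum>\<gamma>\<in>avoiding_paths m n D (p, Suc c) Q. path_weight x y \<gamma>))"
proof -
  let ?U = "avoiding_paths m n D (p - 1, c) Q" and ?R = "avoiding_paths m n D (p, Suc c) Q"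
  have p: "p \<ge> 1" using assms(1) by (simp add: grid_def)
  have new: "(p, c) \<notin> set \<gamma>" if "\<gamma> \<in> ?U \<union> ?R" for \<gamma>
    using that p lattice_path_points[of m n _ Q \<gamma> "(p, c)"] by (force simp: avoiding_paths_def)
  have disj: "?U \<inter> ?R = {}"
    by (auto simp: avoiding_paths_def lattice_path_def)
  have "(\<Sum>\<gamma>\<in>avoiding_paths m n D (p, c) Q. path_weight x y \<gamma>) =
      (\<Sum>\<gamma>\<in>?U \<union> ?R. path_weight x y ((p, c) # \<gamma>))"
    unfolding avoiding_paths_first_step[OF assms] by (subst sum.reindex) (auto simp: o_def)
  also have "\<dots> = (\<Sum>\<gamma>\<in>?U \<union> ?R. 1 / (x p + y c) * path_weight x y \<gamma>)"
    by (intro sum.cong refl path_weight_Cons new)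
  also have "\<dots> = 1 / (x p + y c) * (\<Sum>\<gamma>\<in>?U \<union> ?R. path_weight x y \<gamma>)"
    by (rule sum_distrib_left[symmetric])
  also have "(\<Sum>\<gamma>\<in>?U \<union> ?R. path_weight x y \<gamma>) = sum (path_weight x y) ?U + sum (path_weight x y) ?R"
    by (intro sum.union_disjoint disj finite_avoiding_paths)
  finally show ?thesis .
qed

section \<open>Advancing one starting point\<close>

text \<open>
  Writing disjointness with \<^const>\<open>sorted_wrt\<close> and the end points with \<^const>\<open>list_all2\<close> lets both be
  split along appended lists, without index arithmetic.
\<close>

lemma nonintersecting_paths_iff:
  "\<Upsilon> \<in> nonintersecting_paths m n As Bs \<longleftrightarrow>
     length As = length Bs \<and>
     list_all2 (\<lambda>(P, Q). lattice_path m n P Q) (zip As Bs) \<Upsilon> \<and>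
     sorted_wrt (\<lambda>\<gamma> \<delta>. set \<gamma> \<inter> set \<delta> = {}) \<Upsilon>"
proof -
  have "(\<forall>i < length \<Upsilon>. \<forall>j < length \<Upsilon>. i \<noteq> j \<longrightarrow> set (\<Upsilon> ! i) \<inter> set (\<Upsilon> ! j) = {}) \<longleftrightarrow>
      sorted_wrt (\<lambda>\<gamma> \<delta>. set \<gamma> \<inter> set \<delta> = {}) \<Upsilon>"
    (is "?L \<longleftrightarrow> ?R")
  proof
    assume ?L then show ?R by (auto simp: sorted_wrt_iff_nth_less)
  next
    assume R: ?R
    have "set (\<Upsilon> ! i) \<inter> set (\<Upsilon> ! j) = {}" if "i < length \<Upsilon>" "j < length \<Upsilon>" "i \<noteq> j" for i j
      using sorted_wrt_nth_less[OF R, of i j] sorted_wrt_nth_less[OF R, of j i] that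
      by (cases "i < j") (simp_all add: inf_commute)
    then show ?L by blast
  qed
  then show ?thesis
    unfolding nonintersecting_paths_def list_all2_conv_all_nth by auto
qed

lemma nonintersecting_paths_insert:
  assumes "length Us = length Us'" "length \<Gamma> = length Us"
  shows "\<Gamma> @ \<gamma> # \<Gamma>' \<in> nonintersecting_paths m n (Us @ v # Ws) (Us' @ q # Ws') \<longleftrightarrow>
    \<Gamma> @ \<Gamma>' \<in> nonintersecting_paths m n (Us @ Ws) (Us' @ Ws') \<and>
    \<gamma> \<in> avoiding_paths m n (\<Union> (set ` set (\<Gamma> @ \<Gamma>'))) v q"
proof -
  have comm: "(\<forall>\<delta>\<in>set \<Gamma>. set \<delta> \<inter> set \<gamma> = {}) \<longleftrightarrow> (\<forall>\<delta>\<in>set \<Gamma>. set \<gamma> \<inter> set \<delta> = {})"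
    by blast
  have "sorted_wrt (\<lambda>\<gamma> \<delta>. set \<gamma> \<inter> set \<delta> = {}) (\<Gamma> @ \<gamma> # \<Gamma>') \<longleftrightarrow>
      sorted_wrt (\<lambda>\<gamma> \<delta>. set \<gamma> \<inter> set \<delta> = {}) (\<Gamma> @ \<Gamma>') \<and>
      (\<forall>\<delta>\<in>set (\<Gamma> @ \<Gamma>'). set \<gamma> \<inter> set \<delta> = {})"
    by (simp add: sorted_wrt_append comm ball_Un ball_conj_distrib) blast
  moreover have "(\<forall>\<delta>\<in>set (\<Gamma> @ \<Gamma>'). set \<gamma> \<inter> set \<delta> = {}) \<longleftrightarrow>
      set \<gamma> \<inter> \<Union> (set ` set (\<Gamma> @ \<Gamma>')) = {}"
    by blast
  moreover have "list_all2 (\<lambda>(P, Q). lattice_path m n P Q)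
        (zip (Us @ v # Ws) (Us' @ q # Ws')) (\<Gamma> @ \<gamma> # \<Gamma>') \<longleftrightarrow>
      list_all2 (\<lambda>(P, Q). lattice_path m n P Q) (zip (Us @ Ws) (Us' @ Ws')) (\<Gamma> @ \<Gamma>') \<and>
      lattice_path m n v q \<gamma>"
    using assms by (auto simp: list_all2_append)
  ultimately show ?thesis
    unfolding nonintersecting_paths_iff avoiding_paths_def by auto
qed

lemma paths_weight_conv_prod_list:
  "paths_weight x y \<Upsilon> = prod_list (map (path_weight x y) \<Upsilon>)"
  by (simp add: paths_weight_def prod.list_conv_set_nth atLeast0LessThan)

text \<open>
  Summing over the path with one chosen index last, with all other paths held fixed: the others only
  enter as a set of forbidden points.
\<close>

lemma path_sum_insert:
  assumes "length Us = length Us'"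
  shows "path_sum m n (Us @ v # Ws) (Us' @ q # Ws') x y =
    (\<Sum>\<Delta>\<in>nonintersecting_paths m n (Us @ Ws) (Us' @ Ws'). paths_weight x y \<Delta> *
       (\<Sum>\<gamma>\<in>avoiding_paths m n (\<Union> (set ` set \<Delta>)) v q. path_weight x y \<gamma>))"
proof -
  let ?N = "nonintersecting_paths m n (Us @ v # Ws) (Us' @ q # Ws')"
  let ?N' = "nonintersecting_paths m n (Us @ Ws) (Us' @ Ws')"
  let ?A = "\<lambda>\<Delta>. avoiding_paths m n (\<Union> (set ` set \<Delta>)) v q"
  define l where "l = length Us"
  have ins: "take l \<Delta> @ \<gamma> # drop l \<Delta> \<in> ?N \<longleftrightarrow> \<Delta> \<in> ?N' \<and> \<gamma> \<in> ?A \<Delta>"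
    if "l \<le> length \<Delta>" for \<Delta> \<gamma>
    using nonintersecting_paths_insert[OF assms, of "take l \<Delta>" \<gamma> "drop l \<Delta>"] that
    by (simp add: l_def)
  have len': "l \<le> length \<Delta>" if "\<Delta> \<in> ?N'" for \<Delta>
    using that by (simp add: nonintersecting_paths_def l_def)
  have len: "l < length \<Upsilon>" if "\<Upsilon> \<in> ?N" for \<Upsilon>
    using that by (simp add: nonintersecting_paths_def l_def)
  have restore: "take l (take l \<Upsilon> @ drop (Suc l) \<Upsilon>) @ \<Upsilon> ! l # drop l (take l \<Upsilon> @ drop (Suc l) \<Upsilon>) = \<Upsilon>"
    if "l < length \<Upsilon>" for \<Upsilon> :: "point list list"
    using that by (simp add: id_take_nth_drop[symmetric])
  have "path_sum m n (Us @ v # Ws) (Us' @ q # Ws') x y =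
      (\<Sum>(\<Delta>, \<gamma>)\<in>Sigma ?N' ?A. paths_weight x y \<Delta> * path_weight x y \<gamma>)"
    unfolding path_sum_def
  proof (rule sum.reindex_bij_witness[where
        i = "\<lambda>(\<Delta>, \<gamma>). take l \<Delta> @ \<gamma> # drop l \<Delta>" and
        j = "\<lambda>\<Upsilon>. (take l \<Upsilon> @ drop (Suc l) \<Upsilon>, \<Upsilon> ! l)"], goal_cases)
    case (1 \<Upsilon>)
    then show ?case using restore[OF len[OF 1]] by simp
  next
    case (2 \<Upsilon>)
    then show ?case
      using ins[of "take l \<Upsilon> @ drop (Suc l) \<Upsilon>" "\<Upsilon> ! l"] restore[OF len[OF 2]] len[OF 2] by simp
  next
    case (3 u)
    then show ?case using len' by (force simp: nth_append min_def)
  next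
    case (4 u)
    then show ?case using ins len' by force
  next
    case (5 \<Upsilon>)
    have "paths_weight x y (take l \<Upsilon> @ drop (Suc l) \<Upsilon>) * path_weight x y (\<Upsilon> ! l) =
        paths_weight x y (take l \<Upsilon> @ \<Upsilon> ! l # drop (Suc l) \<Upsilon>)"
      by (simp add: paths_weight_conv_prod_list)
    also have "\<dots> = paths_weight x y \<Upsilon>"
      using len[OF 5] by (simp add: id_take_nth_drop[symmetric])
    finally show ?case by simp
  qed
  also have "\<dots> = (\<Sum>\<Delta>\<in>?N'. \<Sum>\<gamma>\<in>?A \<Delta>. paths_weight x y \<Delta> * path_weight x y \<gamma>)"
    by (intro sum.Sigma[symmetric] finite_nonintersecting_paths ballI finite_avoiding_paths)
  finally show ?thesis
    by (simp add: sum_distrib_left)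
qed

text \<open>
  Paths move up and to the right, so a path can visit only points weakly above and weakly to the right
  of its start.
\<close>

definition unreachable :: "point \<Rightarrow> point set \<Rightarrow> bool" where
  "unreachable v T \<longleftrightarrow> (\<forall>u\<in>T. \<not> (snd u \<le> snd v \<and> fst v \<le> fst u))"

lemma nonintersecting_paths_memD:
  assumes "\<Upsilon> \<in> nonintersecting_paths m n As Bs" "\<gamma> \<in> set \<Upsilon>"
  obtains P Q where "P \<in> set As" "Q \<in> set Bs" "lattice_path m n P Q \<gamma>"
proof -
  obtain i where i: "i < length \<Upsilon>" "\<gamma> = \<Upsilon> ! i"
    using assms(2) by (auto simp: in_set_conv_nth)
  then have "lattice_path m n (As ! i) (Bs ! i) \<gamma>" "As ! i \<in> set As" "Bs ! i \<in> set Bs"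
    using assms(1) by (auto simp: nonintersecting_paths_def)
  then show ?thesis by (rule that[rotated 2])
qed

lemma unreachable_not_visited:
  assumes "unreachable v (set As)" "\<Upsilon> \<in> nonintersecting_paths m n As Bs"
  shows "v \<notin> \<Union> (set ` set \<Upsilon>)"
proof
  assume "v \<in> \<Union> (set ` set \<Upsilon>)"
  then obtain \<gamma> where \<gamma>: "\<gamma> \<in> set \<Upsilon>" "v \<in> set \<gamma>" by blast
  obtain P Q where "P \<in> set As" "lattice_path m n P Q \<gamma>"
    using nonintersecting_paths_memD[OF assms(2) \<gamma>(1)] .
  then show False
    using assms(1) lattice_path_points[OF _ \<gamma>(2)] unfolding unreachable_def by blast
qed

lemma path_sum_length_neq:
  "length As \<noteq> length Bs \<Longrightarrow> path_sum m n As Bs x y = 0"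
proof -
  assume "length As \<noteq> length Bs"
  then have "nonintersecting_paths m n As Bs = {}"
    unfolding nonintersecting_paths_def by force
  then show ?thesis by (simp add: path_sum_def)
qed

text \<open>
  A starting point that no other path can reach may be replaced by its two possible successors: after
  removing it from its path, nothing prevents the others from remaining as they are. A successor
  outside the grid contributes an empty sum.
\<close>

lemma path_sum_step:
  assumes v: "(p, c) \<in> grid m n" "(p, c) \<notin> set Bs" "unreachable (p, c) (set (Us @ Ws))"
  shows "path_sum m n (Us @ (p, c) # Ws) Bs x y = 1 / (x p + y c) *
    (path_sum m n (Us @ (p - 1, c) # Ws) Bs x y + path_sum m n (Us @ (p, Suc c) # Ws) Bs x y)"
proof (cases "length Us < length Bs")
  case True
  define Us' q Ws' where "Us' = take (length Us) Bs" "q = Bs ! length Us" "Ws' = drop (Suc (length Us)) Bs"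
  have Bs: "Bs = Us' @ q # Ws'" and len: "length Us = length Us'"
    using True by (simp_all add: Us'_q_Ws'_def id_take_nth_drop[symmetric])
  have "(p, c) \<noteq> q" using v(2) Bs by auto
  let ?N = "nonintersecting_paths m n (Us @ Ws) (Us' @ Ws')"
  let ?P = "\<lambda>\<Delta> u. paths_weight x y \<Delta> *
    (\<Sum>\<gamma>\<in>avoiding_paths m n (\<Union> (set ` set \<Delta>)) u q. path_weight x y \<gamma>)"
  have "?P \<Delta> (p, c) = 1 / (x p + y c) * (?P \<Delta> (p - 1, c) + ?P \<Delta> (p, Suc c))" if "\<Delta> \<in> ?N" for \<Delta>
    unfolding avoiding_path_sum_first_step[OF v(1) unreachable_not_visited[OF v(3) that] \<open>(p, c) \<noteq> q\<close>]
    by (simp only: distrib_left mult.left_commute)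
  then have "(\<Sum>\<Delta>\<in>?N. ?P \<Delta> (p, c)) = (\<Sum>\<Delta>\<in>?N. 1 / (x p + y c) * (?P \<Delta> (p - 1, c) + ?P \<Delta> (p, Suc c)))"
    by (intro sum.cong refl)
  also have "\<dots> = 1 / (x p + y c) * (\<Sum>\<Delta>\<in>?N. ?P \<Delta> (p - 1, c) + ?P \<Delta> (p, Suc c))"
    by (rule sum_distrib_left[symmetric])
  finally show ?thesis
    unfolding Bs path_sum_insert[OF len] sum.distrib .
next
  case False
  then have "path_sum m n (Us @ u # Ws) Bs x y = 0" for u
    by (intro path_sum_length_neq) simp
  then show ?thesis by simp
qed

text \<open>
  A path from a point to itself consists of this point only. Equal positions in the two lists of
  points are needed for the pairing of the remaining points to stay the same.
\<close>

lemma path_sum_end: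
  assumes v: "(p, c) \<in> grid m n" "unreachable (p, c) (set (Us @ Ws))" and len: "length Us = length Us'"
  shows "path_sum m n (Us @ (p, c) # Ws) (Us' @ (p, c) # Ws') x y =
    1 / (x p + y c) * path_sum m n (Us @ Ws) (Us' @ Ws') x y"
proof -
  have "path_sum m n (Us @ (p, c) # Ws) (Us' @ (p, c) # Ws') x y =
      (\<Sum>\<Delta>\<in>nonintersecting_paths m n (Us @ Ws) (Us' @ Ws'). 1 / (x p + y c) * paths_weight x y \<Delta>)"
    unfolding path_sum_insert[OF len]
    by (intro sum.cong refl)
       (simp add: avoiding_paths_trivial[OF v(1) unreachable_not_visited[OF v(2)]] path_weight_def)
  then show ?thesis
    by (simp add: path_sum_def sum_distrib_left)
qed

lemma path_sum_not_distinct: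
  assumes "\<not> distinct As"
  shows "path_sum m n As Bs x y = 0"
proof -
  have "nonintersecting_paths m n As Bs = {}"
  proof (rule ccontr)
    assume "nonintersecting_paths m n As Bs \<noteq> {}"
    then obtain \<Upsilon> where \<Upsilon>: "\<Upsilon> \<in> nonintersecting_paths m n As Bs" by blast
    obtain i j where ij: "i < length As" "j < length As" "i \<noteq> j" "As ! i = As ! j"
      using assms by (auto simp: distinct_conv_nth)
    have "As ! l \<in> set (\<Upsilon> ! l)" if "l < length As" for l
    proof -
      have "\<Upsilon> ! l \<noteq> []" "hd (\<Upsilon> ! l) = As ! l"
        using \<Upsilon> that by (auto simp: nonintersecting_paths_def lattice_path_def)
      then show ?thesis by (metis hd_in_set)
    qed
    then have "As ! i \<in> set (\<Upsilon> ! i) \<inter> set (\<Upsilon> ! j)"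
      using ij by (metis IntI)
    moreover have "set (\<Upsilon> ! i) \<inter> set (\<Upsilon> ! j) = {}"
      using \<Upsilon> ij unfolding nonintersecting_paths_def by simp
    ultimately show False by blast
  qed
  then show ?thesis by (simp add: path_sum_def)
qed

lemma path_sum_unreachable_end:
  assumes "i < length Bs" "i < length As \<Longrightarrow> unreachable (Bs ! i) {As ! i}"
  shows "path_sum m n As Bs x y = 0"
proof -
  have "\<Upsilon> \<notin> nonintersecting_paths m n As Bs" for \<Upsilon>
  proof
    assume \<Upsilon>: "\<Upsilon> \<in> nonintersecting_paths m n As Bs"
    then have i: "i < length As" and l: "lattice_path m n (As ! i) (Bs ! i) (\<Upsilon> ! i)"
      using assms(1) by (auto simp: nonintersecting_paths_def)
    have "Bs ! i \<in> set (\<Upsilon> ! i)"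
      using l unfolding lattice_path_def by (metis last_in_set)
    then show False
      using lattice_path_points[OF l] assms(2)[OF i] by (auto simp: unreachable_def)
  qed
  then have "nonintersecting_paths m n As Bs = {}" by blast
  then show ?thesis by (simp add: path_sum_def)
qed


lemma path_sum_start_off_grid:
  assumes "u \<in> set As" "u \<notin> grid m n"
  shows "path_sum m n As Bs x y = 0"
proof -
  obtain i where i: "i < length As" "u = As ! i"
    using assms(1) by (auto simp: in_set_conv_nth)
  have "\<Upsilon> \<notin> nonintersecting_paths m n As Bs" for \<Upsilon>
  proof
    assume "\<Upsilon> \<in> nonintersecting_paths m n As Bs"
    then have "\<Upsilon> ! i \<noteq> []" "hd (\<Upsilon> ! i) = u" "set (\<Upsilon> ! i) \<subseteq> grid m n"
      using i by (auto simp: nonintersecting_paths_def lattice_path_def)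
    then show False
      using assms(2) by (metis hd_in_set subsetD)
  qed
  then have "nonintersecting_paths m n As Bs = {}" by blast
  then show ?thesis by (simp add: path_sum_def)
qed

section \<open>The path sum as an iterated sum over columns\<close>

text \<open>
  A column is swept from its bottom row upwards, \<open>p\<close> being the row to be treated next. The set \<open>S\<close>
  contains the rows up to \<open>p\<close> at which a path is waiting, whether it came from the left, started there,
  or (for row \<open>p\<close>) just came from below; \<open>R\<close> collects the rows in which a path has stepped right. The
  top \<open>b\<close> points are end points, so each of them must be occupied, and a path meeting one stops.
  A path moving up may neither leave the grid nor meet a waiting path. Once the column is done,
  \<open>g\<close> continues with the set of exits.
\<close>

primrec column_sum ::
    "(nat \<Rightarrow> 'f::field) \<Rightarrow> nat \<Rightarrow> (nat set \<Rightarrow> 'f) \<Rightarrow> nat \<Rightarrow> nat set \<Rightarrow> nat set \<Rightarrow> 'f" where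
  "column_sum w b g 0 S R = g R"
| "column_sum w b g (Suc p) S R =
    (if Suc p \<in> S then
       w (Suc p) *
        (if Suc p \<le> b then column_sum w b g p (S - {Suc p}) R
         else (if p = 0 \<or> p \<in> S then 0 else column_sum w b g p (insert p (S - {Suc p})) R) +
              column_sum w b g p (S - {Suc p}) (insert (Suc p) R))
     else if Suc p \<le> b then 0 else column_sum w b g p S R)"

text \<open>
  In each column of the list, the paths arriving from the left in the rows \<open>R\<close> are joined by those
  starting in the bottom block of the column, which they must not hit.
\<close>

primrec grid_sum ::
    "(nat \<Rightarrow> 'f::field) \<Rightarrow> (nat \<Rightarrow> 'f) \<Rightarrow> nat \<Rightarrow> (nat \<Rightarrow> nat) \<Rightarrow> (nat \<Rightarrow> nat) \<Rightarrow>
      nat list \<Rightarrow> nat set \<Rightarrow> 'f" where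
  "grid_sum x y m a b [] R = (if R = {} then 1 else 0)"
| "grid_sum x y m a b (c # cs) R =
    (if R \<inter> {m - a c<..m} = {} then
       column_sum (\<lambda>p. 1 / (x p + y c)) (b c) (grid_sum x y m a b cs) m (R \<union> {m - a c<..m}) {}
     else 0)"

definition in_column :: "nat \<Rightarrow> nat set \<Rightarrow> point list" where
  "in_column c S = map (\<lambda>p. (p, c)) (sorted_list_of_set S)"

lemma in_column_empty [simp]: "in_column c {} = []"
  by (simp add: in_column_def)

lemma in_column_singleton [simp]: "in_column c {p} = [(p, c)]"
  by (simp add: in_column_def)

lemma set_in_column [simp]: "finite S \<Longrightarrow> set (in_column c S) = S \<times> {c}"
  by (auto simp: in_column_def)

lemma length_in_column [simp]: "length (in_column c S) = card S"
  by (simp add: in_column_def)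

lemma in_column_Un:
  assumes "finite S" "finite T" "\<And>s t. s \<in> S \<Longrightarrow> t \<in> T \<Longrightarrow> s < t"
  shows "in_column c (S \<union> T) = in_column c S @ in_column c T"
proof -
  have "sorted_list_of_set (S \<union> T) = sorted_list_of_set S @ sorted_list_of_set T"
    by (rule sorted_distinct_set_unique)
       (use assms in \<open>auto simp: sorted_append intro: less_imp_le\<close>)
  then show ?thesis by (simp add: in_column_def)
qed

text \<open>
  A path waiting at an end point stops there and cannot serve another one. So when all remaining rows
  are end points, a path must already be waiting in each of them.
\<close>

lemma column_sum_eq_0:
  assumes "p \<le> b" "\<not> {1..p} \<subseteq> S"
  shows "column_sum w b g p S R = 0"
  using assms
proof (induction p arbitrary: S)
  case (Suc p)
  have "\<not> {1..p} \<subseteq> S - {Suc p}" if "Suc p \<in> S"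
  proof
    assume sub: "{1..p} \<subseteq> S - {Suc p}"
    have "{1..Suc p} = insert (Suc p) {1..p}" by auto
    then show False using sub that Suc.prems(2) by auto
  qed
  then show ?case using Suc by simp
qed simp

text \<open>
  The path sum with intermediate starting points \<open>S\<close> in column \<open>c\<close> and \<open>R\<close> in the next column. In the
  sums that occur, the starting points are listed by columns from left to right and within a column
  from top to bottom, unless two of them coincide and there are no disjoint paths at all. The point moved is the last one of column \<open>c\<close>. If it moves up, it remains the last one there;
  if it moves right in row \<open>p\<close>, it becomes the first one of the next column, because the rows in \<open>R\<close> are
  all larger than \<open>p\<close>. Hence the pairing by position never has to be changed. If the point is an end
  point, it is the last one of its column in the list of end points as well; it then has the same
  position in both lists exactly if all end points of the column are occupied, and otherwise both
  sides are \<open>0\<close>.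
\<close>

lemma column_sum_eq_path_sum:
  fixes x y :: "nat \<Rightarrow> 'f::field" and As Bs :: "point list"
  assumes c: "1 \<le> c" "c \<le> n"
    and right: "\<And>u. u \<in> set As \<union> set Bs \<Longrightarrow> c < snd u"
    and g: "\<And>R. R \<subseteq> {1..m} \<Longrightarrow> g R = path_sum m n (in_column (Suc c) R @ As) Bs x y"
    and "p \<le> m" "S \<subseteq> {1..p}" "R \<subseteq> {p<..m}"
  shows "column_sum (\<lambda>p. 1 / (x p + y c)) b g p S R =
    path_sum m n (in_column c S @ in_column (Suc c) R @ As) (in_column c {1..min p b} @ Bs) x y"
  using assms(5-7)
proof (induction p arbitrary: S R)
  case 0
  then have "S = {}" by auto
  moreover have "R \<subseteq> {1..m}" using 0 by auto
  ultimately show ?case using g by simp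
next
  case (Suc p)
  let ?C = "column_sum (\<lambda>p. 1 / (x p + y c)) b g"
  let ?P = "\<lambda>As Bs. path_sum m n As Bs x y"
  have fin: "finite S" "finite R"
    using Suc.prems by (auto intro: finite_subset)
  have rest: "c < snd u" if "u \<in> set (in_column (Suc c) R @ As)" for u
    using that fin right[of u] by auto
  have grid: "(Suc p, c) \<in> grid m n"
    using c Suc.prems by (auto simp: grid_def)
  have end_last: "in_column c {1..min (Suc p) b} = in_column c {1..p} @ [(Suc p, c)]" if "Suc p \<le> b"
  proof -
    have "{1..min (Suc p) b} = {1..p} \<union> {Suc p}" using that by auto
    moreover have "in_column c ({1..p} \<union> {Suc p}) = in_column c {1..p} @ in_column c {Suc p}"
      by (rule in_column_Un) auto
    ultimately show ?thesis by simp
  qed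
  show ?case
  proof (cases "Suc p \<in> S")
    case True
    define S' where "S' = S - {Suc p}"
    have S': "S' \<subseteq> {1..p}" "Suc p \<notin> S'" "finite S'"
      using Suc.prems fin by (auto simp: S'_def le_Suc_eq)
    have S: "in_column c S = in_column c S' @ [(Suc p, c)]"
    proof -
      have "S = S' \<union> {Suc p}" using True by (auto simp: S'_def)
      moreover have "in_column c (S' \<union> {Suc p}) = in_column c S' @ in_column c {Suc p}"
        using S' by (intro in_column_Un) auto
      ultimately show ?thesis by simp
    qed
    have unreach: "unreachable (Suc p, c) (set (in_column c S' @ in_column (Suc c) R @ As))"
    proof -
      have "\<not> (snd u \<le> c \<and> Suc p \<le> fst u)" if "u \<in> set (in_column c S' @ in_column (Suc c) R @ As)" for u
        using that rest[of u] S' by auto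
      then show ?thesis unfolding unreachable_def fst_conv snd_conv by blast
    qed
    show ?thesis
    proof (cases "Suc p \<le> b")
      case True
      show ?thesis
      proof (cases "S' = {1..p}")
        case full: True
        have "?P (in_column c S @ in_column (Suc c) R @ As) (in_column c {1..min (Suc p) b} @ Bs) =
            1 / (x (Suc p) + y c) *
            ?P (in_column c S' @ in_column (Suc c) R @ As) (in_column c S' @ Bs)"
          using path_sum_end[OF grid unreach refl] unfolding S end_last[OF True] full by simp
        also have "?P (in_column c S' @ in_column (Suc c) R @ As) (in_column c S' @ Bs) = ?C p S' R"
        proof -
          have "min p b = p" using True by simp
          moreover have "R \<subseteq> {p<..m}" using Suc.prems by auto
          ultimately show ?thesis
            using Suc.IH[of S' R] Suc.prems full by simp
        qed
        finally show ?thesis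
          using True \<open>Suc p \<in> S\<close> by (simp add: S'_def)
      next
        case False
        have "?C p S' R = 0"
          using column_sum_eq_0[of p b S'] True False S' by auto
        then have "?C (Suc p) S R = 0"
          using True \<open>Suc p \<in> S\<close> by (simp add: S'_def)
        moreover have "?P (in_column c S @ in_column (Suc c) R @ As) (in_column c {1..min (Suc p) b} @ Bs) = 0"
        proof (rule path_sum_unreachable_end[where i = p])
          let ?As = "in_column c S @ in_column (Suc c) R @ As"
          let ?Bs = "in_column c {1..min (Suc p) b} @ Bs"
          show "p < length ?Bs" using True by simp
          \<comment> \<open>Column \<open>c\<close> has too few starting points, so the one at the position of the end point
            \<open>(Suc p, c)\<close> lies in a later column.\<close>
          have "card S' < p"
            using psubset_card_mono[of "{1..p}" S'] False S' by auto
          then have len: "length (in_column c S) \<le> p" by (simp add: S del: length_in_column) simp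
          assume "p < length ?As"
          then have "?As ! p \<in> set (in_column (Suc c) R @ As)"
            using len by (subst nth_append_right[OF len]) (rule nth_mem, simp)
          moreover have "?Bs ! p = (Suc p, c)"
            unfolding end_last[OF True] by (simp add: nth_append)
          ultimately show "unreachable (?Bs ! p) {?As ! p}"
            using rest[of "?As ! p"] by (simp add: unreachable_def)
        qed
        ultimately show ?thesis by simp
      qed
    next
      case False
      then have b: "min (Suc p) b = min p b" by simp
      let ?Bs = "in_column c {1..min p b} @ Bs"
      have "?P (in_column c S @ in_column (Suc c) R @ As) ?Bs = 1 / (x (Suc p) + y c) *
          (?P (in_column c S' @ (p, c) # in_column (Suc c) R @ As) ?Bs +
           ?P (in_column c S' @ (Suc p, Suc c) # in_column (Suc c) R @ As) ?Bs)"
      proof -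
        have "(Suc p, c) \<notin> set ?Bs"
          using right[of "(Suc p, c)"] by auto
        from path_sum_step[OF grid this unreach] show ?thesis
          unfolding S by simp
      qed
      also have "?P (in_column c S' @ (p, c) # in_column (Suc c) R @ As) ?Bs =
          (if p = 0 \<or> p \<in> S' then 0 else ?C p (insert p S') R)"
      proof (cases "p = 0 \<or> p \<in> S'")
        case True
        \<comment> \<open>The path would leave the grid at the top or hit the next waiting path.\<close>
        have "?P (in_column c S' @ (p, c) # in_column (Suc c) R @ As) ?Bs = 0"
        proof (cases "p = 0")
          case True
          then show ?thesis
            by (intro path_sum_start_off_grid[of "(p, c)"]) (auto simp: grid_def)
        next
          case False
          then have "p \<in> S'" using True by simp
          then show ?thesis
            using S'(3) by (intro path_sum_not_distinct) auto
        qed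
        then show ?thesis using True by simp
      next
        case False
        have "in_column c (S' \<union> {p}) = in_column c S' @ in_column c {p}"
        proof (rule in_column_Un)
          show "s < t" if "s \<in> S'" "t \<in> {p}" for s t
            using that False S'(1) by (cases "s = p") auto
        qed (use S' in auto)
        moreover have "insert p S' \<subseteq> {1..p}" "R \<subseteq> {p<..m}"
          using False S' Suc.prems by auto
        ultimately show ?thesis
          using Suc.IH[of "insert p S'" R] False Suc.prems by simp
      qed
      also have "?P (in_column c S' @ (Suc p, Suc c) # in_column (Suc c) R @ As) ?Bs =
          ?C p S' (insert (Suc p) R)"
      proof -
        have "in_column (Suc c) ({Suc p} \<union> R) = in_column (Suc c) {Suc p} @ in_column (Suc c) R"
          using Suc.prems fin by (intro in_column_Un) auto
        moreover have "insert (Suc p) R \<subseteq> {p<..m}" using Suc.prems by auto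
        ultimately show ?thesis
          using Suc.IH[of S' "insert (Suc p) R"] S' Suc.prems by simp
      qed
      finally show ?thesis
        using False \<open>Suc p \<in> S\<close> unfolding b by (simp add: S'_def)
    qed
  next
    case False
    have S: "S \<subseteq> {1..p}"
      using Suc.prems False by (auto simp: le_Suc_eq)
    show ?thesis
    proof (cases "Suc p \<le> b")
      case True
      have "?P (in_column c S @ in_column (Suc c) R @ As) (in_column c {1..min (Suc p) b} @ Bs) = 0"
      proof (rule path_sum_unreachable_end[where i = p])
        let ?As = "in_column c S @ in_column (Suc c) R @ As"
        let ?Bs = "in_column c {1..min (Suc p) b} @ Bs"
        show "p < length ?Bs" using True by simp
        have Bp: "?Bs ! p = (Suc p, c)"
          unfolding end_last[OF True] by (simp add: nth_append)
        assume "p < length ?As"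
        then have "?As ! p \<in> set ?As" by (rule nth_mem)
        then have "fst (?As ! p) < Suc p \<or> c < snd (?As ! p)"
          using rest[of "?As ! p"] S fin by auto
        then show "unreachable (?Bs ! p) {?As ! p}"
          unfolding Bp unreachable_def by auto
      qed
      then show ?thesis using True False by simp
    next
      case b: False
      then have "min (Suc p) b = min p b" by simp
      moreover have "R \<subseteq> {p<..m}" using Suc.prems by auto
      ultimately show ?thesis
        using Suc.IH[of S R] Suc.prems S False b by simp
    qed
  qed
qed

text \<open>
  A set \<open>R\<close> of rows disjoint from the bottom block lies above it, so appending the starting points of
  the column to those in \<open>R\<close> keeps the list ordered.
\<close>

lemma grid_sum_eq_path_sum:
  fixes x y :: "nat \<Rightarrow> 'f::field"
  assumes "1 \<le> c" "c \<le> Suc n" "\<And>i. i \<in> {1..n} \<Longrightarrow> b i \<le> m" "R \<subseteq> {1..m}"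
  shows "grid_sum x y m a b [c..<Suc n] R =
    path_sum m n (in_column c R @ concat (map (\<lambda>i. in_column i {m - a i<..m}) [c..<Suc n]))
      (concat (map (\<lambda>i. in_column i {1..b i}) [c..<Suc n])) x y"
  using assms(2,1,4)
proof (induction c arbitrary: R rule: inc_induct)
  case base
  show ?case
  proof (cases "R = {}")
    case True
    have "nonintersecting_paths m n [] [] = {[]}"
      by (auto simp: nonintersecting_paths_def)
    then show ?thesis using True by (simp add: path_sum_def paths_weight_def)
  next
    case False
    then have "card R \<noteq> 0" using base finite_subset[of R] by auto
    then show ?thesis using False by (simp add: path_sum_length_neq)
  qed
next
  case (step c)
  let ?T = "{m - a c<..m}"
  let ?As = "concat (map (\<lambda>i. in_column i {m - a i<..m}) [Suc c..<Suc n])"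
  let ?Bs = "concat (map (\<lambda>i. in_column i {1..b i}) [Suc c..<Suc n])"
  have fin: "finite R" using step.prems finite_subset by blast
  have upt: "[c..<Suc n] = c # [Suc c..<Suc n]"
    using step by (simp add: upt_conv_Cons)
  have b: "b c \<le> m" using assms(3)[of c] step by auto
  show ?case
  proof (cases "R \<inter> ?T = {}")
    case True
    have "grid_sum x y m a b [c..<Suc n] R =
        column_sum (\<lambda>p. 1 / (x p + y c)) (b c) (grid_sum x y m a b [Suc c..<Suc n]) m (R \<union> ?T) {}"
      unfolding upt using True by simp
    also have "\<dots> = path_sum m n (in_column c (R \<union> ?T) @ in_column (Suc c) {} @ ?As)
        (in_column c {1..min m (b c)} @ ?Bs) x y"
    proof (rule column_sum_eq_path_sum)
      show "c < snd u" if "u \<in> set ?As \<union> set ?Bs" for u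
        using that by (auto simp del: upt_Suc)
      show "grid_sum x y m a b [Suc c..<Suc n] R = path_sum m n (in_column (Suc c) R @ ?As) ?Bs x y"
        if "R \<subseteq> {1..m}" for R
        using step.IH that step.prems by simp
    qed (use step in auto)
    also have "in_column c (R \<union> ?T) = in_column c R @ in_column c ?T"
    proof (intro in_column_Un fin)
      show "s < t" if "s \<in> R" "t \<in> ?T" for s t
        using that True step.prems by (fastforce simp: not_less)
    qed simp
    finally show ?thesis
      unfolding upt using b by (simp del: upt_Suc)
  next
    case False
    have "path_sum m n (in_column c R @ in_column c ?T @ ?As) (in_column c {1..b c} @ ?Bs) x y = 0"
    proof (rule path_sum_not_distinct)
      obtain p where "p \<in> R" "p \<in> ?T" using False by blast
      then have "(p, c) \<in> set (in_column c R)" "(p, c) \<in> set (in_column c ?T)"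
        using fin by simp_all
      then show "\<not> distinct (in_column c R @ in_column c ?T @ ?As)"
        unfolding distinct_append set_append by blast
    qed
    moreover have "grid_sum x y m a b [c..<Suc n] R = 0"
      unfolding upt grid_sum.simps using False by (simp only: if_False)
    ultimately show ?thesis
      unfolding upt by (simp del: upt_Suc)
  qed
qed

section \<open>Interchanging two adjacent row variables\<close>

text \<open>
  The action of the unipotent matrix \<open>1 + d E\<^bsub>r,r+1\<^esub>\<close> on functions of sets of rows. A set
  containing both rows \<open>r\<close> and \<open>r + 1\<close> is not affected because the wedge product in which \<open>r\<close> is
  replaced by \<open>r + 1\<close> has a repeated factor.
\<close>

definition row_exchange :: "'f::field \<Rightarrow> nat \<Rightarrow> (nat set \<Rightarrow> 'f) \<Rightarrow> nat set \<Rightarrow> 'f" where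
  "row_exchange d r f S =
     f S + (if r \<in> S \<and> Suc r \<notin> S then d * f (insert (Suc r) (S - {r})) else 0)"

lemma row_exchange_move:
  "r \<in> S \<Longrightarrow> Suc r \<notin> S \<Longrightarrow> row_exchange d r f S = f S + d * f (insert (Suc r) (S - {r}))"
  by (simp add: row_exchange_def)

lemma row_exchange_fixed: "\<not> (r \<in> S \<and> Suc r \<notin> S) \<Longrightarrow> row_exchange d r f S = f S"
  unfolding row_exchange_def by (simp only: if_False add_0_right)

lemma column_sum_cong_rows:
  assumes "S \<inter> {..p} = T \<inter> {..p}"
  shows "column_sum w b g p S R = column_sum w b g p T R"
  using assms
proof (induction p arbitrary: S T R)
  case (Suc p)
  have mem: "q \<in> S \<longleftrightarrow> q \<in> T" if "q \<le> Suc p" for q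
  proof -
    have "q \<in> S \<inter> {..Suc p} \<longleftrightarrow> q \<in> T \<inter> {..Suc p}" using Suc.prems by simp
    then show ?thesis using that by simp
  qed
  have "column_sum w b g p (S - {Suc p}) R = column_sum w b g p (T - {Suc p}) R" for R
    by (rule Suc.IH) (use mem in auto)
  moreover have "column_sum w b g p (insert p (S - {Suc p})) R =
      column_sum w b g p (insert p (T - {Suc p})) R" for R
    by (rule Suc.IH) (use mem in auto)
  moreover have "column_sum w b g p S R = column_sum w b g p T R" for R
    by (rule Suc.IH) (use mem in auto)
  moreover have "p \<in> S \<longleftrightarrow> p \<in> T" "Suc p \<in> S \<longleftrightarrow> Suc p \<in> T" using mem by auto
  ultimately show ?case by (simp only: column_sum.simps)
qed simp

lemma column_sum_insert_below:
  "p < s \<Longrightarrow> column_sum w b g p (insert s S) R = column_sum w b g p S R"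
  "p < s \<Longrightarrow> column_sum w b g p (insert q (insert s S)) R = column_sum w b g p (insert q S) R"
  by (rule column_sum_cong_rows; auto)+

lemma column_sum_remove_below:
  "p < s \<Longrightarrow> column_sum w b g p (S - {s}) R = column_sum w b g p S R"
  "p < s \<Longrightarrow> column_sum w b g p (insert q (S - {s})) R = column_sum w b g p (insert q S) R"
  by (rule column_sum_cong_rows; auto)+

text \<open>
  Above row \<open>r\<close> the sweep only adds rows other than \<open>r\<close> and \<open>r + 1\<close> to the exits, so the exchange acts
  on the exits and is passed on.
\<close>

lemma column_sum_exchange_above:
  assumes "\<And>q. 1 \<le> q \<Longrightarrow> q < r \<Longrightarrow> w' q = w q" "\<And>R. g' R = row_exchange d r g R" "p < r"
  shows "column_sum w' b g' p S R = row_exchange d r (column_sum w b g p S) R"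
  using assms(3)
proof (induction p arbitrary: S R)
  case (Suc p)
  have R: "insert (Suc r) (insert (Suc p) R - {r}) = insert (Suc p) (insert (Suc r) (R - {r}))"
    using Suc.prems by auto
  have "w' (Suc p) = w (Suc p)" using assms(1) Suc.prems by simp
  then show ?case
    using Suc.prems by (simp add: Suc.IH row_exchange_def R algebra_simps)
qed (simp add: assms(2) row_exchange_def)

text \<open>
  The identities left over in the two rows. Each becomes trivial when \<open>w\<^sub>2 - w\<^sub>1\<close> is replaced by
  \<open>d w\<^sub>1 w\<^sub>2\<close>; here \<open>A\<close>, \<open>A'\<close> and \<open>B\<close> stand for the continuations above the two rows: \<open>B\<close> for those with
  an exit in the lower row, \<open>A\<close> and \<open>A'\<close> for the others.
\<close>

lemma exchange_identities:
  fixes w\<^sub>1 w\<^sub>2 d A A' B :: "'f::field"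
  assumes "w\<^sub>2 = w\<^sub>1 + d * w\<^sub>1 * w\<^sub>2"
  shows "w\<^sub>2 * A = w\<^sub>1 * A + d * (w\<^sub>2 * (w\<^sub>1 * A))"
    and "w\<^sub>1 * (w\<^sub>2 * (A + d * B) + B) = w\<^sub>2 * (w\<^sub>1 * A + B)"
    and "w\<^sub>1 * (w\<^sub>2 * (A + (A' + d * B)) + B) = w\<^sub>2 * (w\<^sub>1 * (A + A') + B)"
    and "w\<^sub>2 * (A + d * B) = w\<^sub>1 * A + d * (w\<^sub>2 * (w\<^sub>1 * A + B))"
    and "w\<^sub>2 * (A + (A' + d * B)) = w\<^sub>1 * (A + A') + d * (w\<^sub>2 * (w\<^sub>1 * (A + A') + B))"
  using assms by algebra+

text \<open>
  In the rows \<open>r\<close> and \<open>r + 1\<close> the exchange moves from the exits to the entries of the column. What is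
  used about the end points is that they do not include the lower row without the upper one.
\<close>

lemma column_sum_exchange_two_rows:
  fixes w w' :: "nat \<Rightarrow> 'f::field"
  assumes w: "\<And>q. 1 \<le> q \<Longrightarrow> q < r \<Longrightarrow> w' q = w q" "w' r = w (Suc r)" "w' (Suc r) = w r"
    and d: "w (Suc r) = w r + d * w r * w (Suc r)"
    and g: "\<And>R. g' R = row_exchange d r g R"
    and r: "1 \<le> r" and R: "r \<notin> R" "Suc r \<notin> R"
  shows "column_sum w' b g' (Suc r) S R = row_exchange d r (\<lambda>S. column_sum w b g (Suc r) S R) S"
proof -
  obtain q where q: "r = Suc q" using r by (cases r) auto
  have R': "insert (Suc r) (insert r R - {r}) = insert (Suc r) R"
    using R by auto
  have ex: "column_sum w' b g' q S T = row_exchange d r (column_sum w b g q S) T" for S T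
    by (rule column_sum_exchange_above[OF w(1) g]) (auto simp: q)
  have ex0: "column_sum w' b g' q S R = column_sum w b g q S R"
    "column_sum w' b g' q S (insert (Suc r) R) = column_sum w b g q S (insert (Suc r) R)"
    "column_sum w' b g' q S (insert r (insert (Suc r) R)) = column_sum w b g q S (insert r (insert (Suc r) R))"
    "column_sum w' b g' q S (insert r R) =
       column_sum w b g q S (insert r R) + d * column_sum w b g q S (insert (Suc r) R)" for S
    using R R' by (simp_all add: ex row_exchange_def)
  note rules = row_exchange_def column_sum_insert_below column_sum_remove_below
    ex0[unfolded q] w(2,3)[unfolded q]
  have d': "w (Suc (Suc q)) = w (Suc q) + d * w (Suc q) * w (Suc (Suc q))"
    using d q by simp
  \<comment> \<open>The cases are: which of the two rows are occupied, which of them are end points, and whether a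
    path could continue up to row \<open>r - 1\<close>. Most of them are settled by unfolding.\<close>
  show ?thesis
    unfolding q
    by (cases "Suc (Suc q) \<in> S"; cases "Suc q \<in> S"; cases "Suc (Suc q) \<le> b"; cases "Suc q \<le> b";
        cases "q = 0 \<or> q \<in> S"; simp add: rules)
       (rule exchange_identities[OF d'])+
qed

text \<open>
  Below row \<open>r + 1\<close> the sweep does not touch the rows \<open>r\<close> and \<open>r + 1\<close> of the entries, apart from a path
  moving up from row \<open>r + 2\<close>. If this path finds row \<open>r + 1\<close> free while \<open>r\<close> is occupied, both rows
  become occupied and the exchange has no effect; in the exchanged set row \<open>r + 1\<close> is taken and the move
  is blocked. The two sides agree.
\<close>

lemma column_sum_exchange:
  fixes w w' :: "nat \<Rightarrow> 'f::field"
  assumes w: "\<And>q. 1 \<le> q \<Longrightarrow> q \<noteq> r \<Longrightarrow> q \<noteq> Suc r \<Longrightarrow> w' q = w q" "w' r = w (Suc r)" "w' (Suc r) = w r"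
    and d: "w (Suc r) = w r + d * w r * w (Suc r)"
    and g: "\<And>R. g' R = row_exchange d r g R"
    and r: "1 \<le> r" "Suc r \<le> p" and R: "r \<notin> R" "Suc r \<notin> R"
  shows "column_sum w' b g' p S R = row_exchange d r (\<lambda>S. column_sum w b g p S R) S"
  using r(2) R
proof (induction p arbitrary: S R rule: dec_induct)
  case base
  show ?case
    by (rule column_sum_exchange_two_rows[OF _ w(2,3) d g r(1) base]) (simp add: w(1))
next
  case (step p)
  let ?C = "column_sum w b g p" and ?C' = "column_sum w' b g' p"
  have ne: "Suc p \<noteq> r" "Suc p \<noteq> Suc r" "p \<noteq> r" "p \<noteq> 0" "p \<ge> Suc r" using step.hyps by auto
  have wp: "w' (Suc p) = w (Suc p)" using w(1) ne by simp
  define S' where "S' = S - {Suc p}"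
  define E where "E = (\<lambda>S. insert (Suc r) (S - {r}))"
  have IH: "?C' T R = ?C T R + (if r \<in> T \<and> Suc r \<notin> T then d * ?C (E T) R else 0)"
    if "r \<notin> R" "Suc r \<notin> R" for T R
    using step.IH[OF that] by (simp add: row_exchange_def E_def)
  have E: "E S - {Suc p} = E S'" "insert p (E S') = E (insert p S')"
    using ne by (auto simp: E_def S'_def)
  have mem: "Suc p \<in> E S \<longleftrightarrow> Suc p \<in> S" "r \<in> S' \<longleftrightarrow> r \<in> S" "Suc r \<in> S' \<longleftrightarrow> Suc r \<in> S"
    "p \<in> E S \<longleftrightarrow> p = Suc r \<or> p \<in> S"
    using ne by (auto simp: E_def S'_def)
  have R': "r \<notin> insert (Suc p) R" "Suc r \<notin> insert (Suc p) R"
    using step.prems ne by auto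
  show ?case
    unfolding row_exchange_def column_sum.simps E_def[symmetric, THEN fun_cong] wp S'_def[symmetric]
    using ne
    by (auto simp: mem E IH[OF step.prems] IH[OF R'] algebra_simps)
qed

text \<open>
  Adding the starting points of a column to the entries is compatible with the exchange because the
  set \<open>T\<close> of their rows contains \<open>r + 1\<close> whenever it contains \<open>r\<close>. The delicate case is an exchange
  that would move an entry from row \<open>r\<close> into \<open>r + 1 \<in> T\<close>: before the starting points are added, the
  moved entry hits one of them and counts \<open>0\<close>; after that, \<open>r + 1\<close> is occupied and nothing is moved.
\<close>

lemma grid_sum_exchange:
  fixes x x' y :: "nat \<Rightarrow> 'f::field"
  assumes nonzero: "\<And>i c. i \<in> {1..m} \<Longrightarrow> c \<in> set cs \<Longrightarrow> x i + y c \<noteq> 0"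
    and r: "1 \<le> r" "Suc r \<le> m" and x': "x' = x \<circ> Transposition.transpose r (Suc r)"
  shows "grid_sum x' y m a b cs R = row_exchange (x r - x (Suc r)) r (grid_sum x y m a b cs) R"
  using nonzero
proof (induction cs arbitrary: R)
  case Nil
  then show ?case by (auto simp: row_exchange_def)
next
  case (Cons c cs)
  let ?d = "x r - x (Suc r)" and ?E = "\<lambda>R. insert (Suc r) (R - {r})"
  let ?w = "\<lambda>p. 1 / (x p + y c)" and ?w' = "\<lambda>p. 1 / (x' p + y c)"
  let ?g = "grid_sum x y m a b cs" and ?g' = "grid_sum x' y m a b cs"
  define T where "T = {m - a c<..m}"
  have T: "r \<in> T \<Longrightarrow> Suc r \<in> T"
    using r by (auto simp: T_def)
  let ?f = "\<lambda>S. column_sum ?w (b c) ?g m S {}"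
  have G: "grid_sum x y m a b (c # cs) R = (if R \<inter> T = {} then ?f (R \<union> T) else 0)"
    "grid_sum x' y m a b (c # cs) R =
      (if R \<inter> T = {} then column_sum ?w' (b c) ?g' m (R \<union> T) {} else 0)" for R
    by (simp_all add: T_def)
  show ?case
  proof (cases "R \<inter> T = {}")
    case disj: True
    have nz: "x r + y c \<noteq> 0" "x (Suc r) + y c \<noteq> 0"
      using Cons.prems r by auto
    have "grid_sum x' y m a b (c # cs) R = column_sum ?w' (b c) ?g' m (R \<union> T) {}"
      unfolding G using disj by (rule if_P)
    also have "\<dots> = row_exchange ?d r ?f (R \<union> T)"
    proof (rule column_sum_exchange)
      show "?g' R = row_exchange ?d r ?g R" for R
        by (rule Cons.IH) (use Cons.prems in auto)
      show "?w (Suc r) = ?w r + ?d * ?w r * ?w (Suc r)"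
      proof -
        have "1 / v = 1 / u + (u - v) * (1 / u) * (1 / v)" if "u \<noteq> 0" "v \<noteq> 0" for u v :: 'f
          using that by (simp add: field_simps)
        from this[OF nz] show ?thesis by (simp only: add_diff_cancel_right)
      qed
    qed (use r in \<open>auto simp: x'\<close>)
    also have "\<dots> = row_exchange ?d r (grid_sum x y m a b (c # cs)) R"
    proof (cases "r \<in> R \<and> Suc r \<notin> R")
      case True
      then have rT: "r \<notin> T" using disj by blast
      have "row_exchange ?d r ?f (R \<union> T) = ?f (R \<union> T) + ?d * grid_sum x y m a b (c # cs) (?E R)"
      proof (cases "Suc r \<in> T")
        case sT: True
        then have "?E R \<inter> T \<noteq> {}" by blast
        then have "grid_sum x y m a b (c # cs) (?E R) = 0" unfolding G by (rule if_not_P)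
        moreover have "row_exchange ?d r ?f (R \<union> T) = ?f (R \<union> T)"
          by (rule row_exchange_fixed) (use sT in blast)
        ultimately show ?thesis by simp
      next
        case False
        then have "?E R \<inter> T = {}" using disj by blast
        then have "grid_sum x y m a b (c # cs) (?E R) = ?f (?E R \<union> T)" unfolding G by (rule if_P)
        moreover have "?E R \<union> T = ?E (R \<union> T)" using rT by blast
        moreover have "row_exchange ?d r ?f (R \<union> T) = ?f (R \<union> T) + ?d * ?f (?E (R \<union> T))"
          by (rule row_exchange_move) (use True False in blast)+
        ultimately show ?thesis by (simp only:)
      qed
      also have "?f (R \<union> T) = grid_sum x y m a b (c # cs) R"
        unfolding G using disj by (rule if_P[symmetric])
      also have "grid_sum x y m a b (c # cs) R + ?d * grid_sum x y m a b (c # cs) (?E R) =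
          row_exchange ?d r (grid_sum x y m a b (c # cs)) R"
        by (rule row_exchange_move[symmetric]) (use True in blast)+
      finally show ?thesis .
    next
      case False
      then have "\<not> (r \<in> R \<union> T \<and> Suc r \<notin> R \<union> T)" using T by blast
      then have "row_exchange ?d r ?f (R \<union> T) = ?f (R \<union> T)" by (rule row_exchange_fixed)
      also have "\<dots> = grid_sum x y m a b (c # cs) R"
        unfolding G using disj by (rule if_P[symmetric])
      also have "\<dots> = row_exchange ?d r (grid_sum x y m a b (c # cs)) R"
        using False by (rule row_exchange_fixed[symmetric])
      finally show ?thesis .
    qed
    finally show ?thesis .
  next
    case False
    then have "?E R \<inter> T \<noteq> {}" using T by blast
    then have "grid_sum x y m a b (c # cs) (?E R) = 0" unfolding G by (rule if_not_P)
    moreover have "grid_sum x y m a b (c # cs) R = 0" "grid_sum x' y m a b (c # cs) R = 0"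
      unfolding G using False by (rule if_not_P)+
    ultimately show ?thesis unfolding row_exchange_def by simp
  qed
qed

section \<open>All permutations of the row variables\<close>

text \<open>
  The predicate \<open>P\<close> has to be carried along because a function may be invariant only at arguments with
  some property, such as having no pole.
\<close>

lemma adjacent_transpositions_invariant:
  assumes adj: "\<And>(x :: nat \<Rightarrow> 'f) r. P x \<Longrightarrow> 1 \<le> r \<Longrightarrow> Suc r \<le> m \<Longrightarrow>
      P (x \<circ> Transposition.transpose r (Suc r)) \<and> f (x \<circ> Transposition.transpose r (Suc r)) = f x"
    and "P x" "\<sigma> permutes {1..m}"
  shows "f (x \<circ> \<sigma>) = f x"
proof -
  define Q where "Q \<tau> \<longleftrightarrow> (\<forall>x. P x \<longrightarrow> P (x \<circ> \<tau>) \<and> f (x \<circ> \<tau>) = f x)" for \<tau>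
  have comp: "Q (\<tau> \<circ> \<tau>')" if "Q \<tau>" "Q \<tau>'" for \<tau> \<tau>'
    using that by (auto simp: Q_def comp_assoc[symmetric])
  have less: "Q (Transposition.transpose i j)" if "1 \<le> i" "i < j" "j \<le> m" for i j
    using that(2,1,3)
  proof (induction j rule: less_Suc_induct)
    case (1 i)
    then show ?case using adj by (simp add: Q_def)
  next
    case (2 i j k)
    have "Transposition.transpose i k =
        Transposition.transpose j k \<circ> (Transposition.transpose i j \<circ> Transposition.transpose j k)"
      using 2(1,2) by (auto simp: fun_eq_iff Transposition.transpose_def)
    moreover have "Q (Transposition.transpose j k \<circ>
        (Transposition.transpose i j \<circ> Transposition.transpose j k))"
      by (intro comp) (use 2 in simp_all)
    ultimately show ?case by (simp only:)
  qed
  have trans: "Q (Transposition.transpose i j)" if "i \<in> {1..m}" "j \<in> {1..m}" "i \<noteq> j" for i j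
    using less[of i j] less[of j i] that by (cases "i < j") (auto simp: transpose_commute)
  have "Q \<sigma>"
    using assms(3) finite_atLeastAtMost
  proof (induction rule: permutes_induct)
    case id
    show ?case by (simp add: Q_def o_def)
  next
    case (swap i j p)
    then show ?case using comp trans by blast
  qed
  then show ?thesis using assms(2) by (simp add: Q_def)
qed

lemma grid_sum_permute:
  fixes x y :: "nat \<Rightarrow> 'f::field"
  assumes "\<sigma> permutes {1..m}" "\<And>i c. i \<in> {1..m} \<Longrightarrow> c \<in> set cs \<Longrightarrow> x i + y c \<noteq> 0"
  shows "grid_sum (x \<circ> \<sigma>) y m a b cs {} = grid_sum x y m a b cs {}"
proof (rule adjacent_transpositions_invariant[where
      P = "\<lambda>x. \<forall>i\<in>{1..m}. \<forall>c\<in>set cs. x i + y c \<noteq> 0" and f = "\<lambda>x. grid_sum x y m a b cs {}"])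
  fix x :: "nat \<Rightarrow> 'f" and r
  assume x: "\<forall>i\<in>{1..m}. \<forall>c\<in>set cs. x i + y c \<noteq> 0" and r: "1 \<le> r" "Suc r \<le> m"
  let ?x = "x \<circ> Transposition.transpose r (Suc r)"
  have "Transposition.transpose r (Suc r) i \<in> {1..m}" if "i \<in> {1..m}" for i
    using that r by (auto simp: Transposition.transpose_def)
  then have "\<forall>i\<in>{1..m}. \<forall>c\<in>set cs. ?x i + y c \<noteq> 0"
    using x unfolding comp_apply by blast
  moreover have "grid_sum ?x y m a b cs {} = grid_sum x y m a b cs {}"
    using grid_sum_exchange[of m cs x y r ?x a b "{}"] x r by (simp add: row_exchange_def)
  ultimately show "(\<forall>i\<in>{1..m}. \<forall>c\<in>set cs. ?x i + y c \<noteq> 0) \<and>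
      grid_sum ?x y m a b cs {} = grid_sum x y m a b cs {}" by blast
qed (use assms in auto)

section \<open>Symmetry of the path sum\<close>

lemma bottom_points_conv:
  "bottom_points m n a = concat (map (\<lambda>i. in_column i {m - a i<..m}) [1..<Suc n])"
proof -
  have "{m - a i<..m} = {m - a i + 1..<m + 1}" for i by auto
  then show ?thesis
    by (simp add: bottom_points_def in_column_def del: upt_Suc)
qed

lemma top_points_conv:
  "top_points n b = concat (map (\<lambda>i. in_column i {1..b i}) [1..<Suc n])"
proof -
  have "{1..b i} = {1..<b i + 1}" for i by auto
  then show ?thesis
    by (simp only: top_points_def in_column_def sorted_list_of_set_range Suc_eq_plus1)
qed

lemma rename_0:
  assumes "bij \<pi>"
  shows "rename \<pi> 0 = 0"
  by (metis rename_add[OF assms] add_0_right add_left_cancel)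

lemma rename_sum:
  assumes "bij \<pi>"
  shows "rename \<pi> (sum f A) = (\<Sum>i\<in>A. rename \<pi> (f i))"
  by (induction A rule: infinite_finite_induct) (simp_all add: assms rename_0 rename_add)

lemma rename_prod:
  assumes "bij \<pi>"
  shows "rename \<pi> (prod f A) = (\<Prod>i\<in>A. rename \<pi> (f i))"
  by (induction A rule: infinite_finite_induct) (simp_all add: assms rename_1 rename_mult)

lemma rename_inverse:
  assumes "bij \<pi>"
  shows "rename \<pi> (1 / f) = 1 / rename \<pi> f"
proof (cases "f = 0")
  case False
  have "rename \<pi> f * rename \<pi> (1 / f) = 1"
    using False by (simp add: rename_mult[OF assms, symmetric] rename_1 assms)
  then show ?thesis
    by (metis div_by_0 mult_zero_left nonzero_mult_div_cancel_left zero_neq_one)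
qed (simp add: rename_0 assms)

text \<open>
  The renaming of variables is a field automorphism, so applying it to the path sum amounts to
  evaluating the path sum at the renamed variables.
\<close>

lemma rename_path_sum:
  assumes "bij \<pi>"
  shows "rename \<pi> (path_sum m n As Bs x y) = path_sum m n As Bs (rename \<pi> \<circ> x) (rename \<pi> \<circ> y)"
  by (simp add: path_sum_def paths_weight_def path_weight_def assms rename_sum rename_prod
      rename_inverse rename_add split_beta)

theorem theorem3p3:
  fixes m n k :: nat and a b :: "nat \<Rightarrow> nat"
  assumes "m \<ge> 1" and "n \<ge> 1" and "k \<ge> 1"
    and "\<And>i. i \<in> {1..n} \<Longrightarrow> a i \<le> m"
    and "\<And>i. i \<in> {1..n} \<Longrightarrow> b i \<le> m"
    and "(\<Sum>i=1..n. a i) = k"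
    and "(\<Sum>i=1..n. b i) = k"
  shows "symmetric_in_x m (F_ratfun m n (bottom_points m n a) (top_points n b) :: 'c::field ratfun)"
  unfolding symmetric_in_x_def
proof (intro allI impI)
  fix \<sigma> assume \<sigma>: "\<sigma> permutes {1..m}"
  let ?\<pi> = "permute_X \<sigma>"
  let ?G = "\<lambda>x :: nat \<Rightarrow> 'c ratfun. grid_sum x y_var m a b [1..<Suc n] {}"
  have \<pi>: "bij ?\<pi>" by (rule bij_permute_X[OF \<sigma>])
  have F: "path_sum m n (bottom_points m n a) (top_points n b) x y_var = ?G x" for x
    using grid_sum_eq_path_sum[of 1 n b m "{}" x y_var a] assms(5)
    by (simp add: bottom_points_conv top_points_conv del: upt_Suc)
  have "rename ?\<pi> (F_ratfun m n (bottom_points m n a) (top_points n b) :: 'c ratfun) =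
      path_sum m n (bottom_points m n a) (top_points n b) (x_var \<circ> \<sigma>) y_var"
    unfolding F_ratfun_def rename_path_sum[OF \<pi>] by (simp add: o_def rename_indet[OF \<pi>])
  also have "\<dots> = ?G (x_var \<circ> \<sigma>)" by (rule F)
  also have "\<dots> = ?G x_var"
    by (rule grid_sum_permute[OF \<sigma> x_var_plus_y_var_nonzero])
  also have "\<dots> = F_ratfun m n (bottom_points m n a) (top_points n b)"
    unfolding F_ratfun_def by (rule F[symmetric])
  finally show "rename ?\<pi> (F_ratfun m n (bottom_points m n a) (top_points n b) :: 'c ratfun) =
      F_ratfun m n (bottom_points m n a) (top_points n b)" .
qed

end
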